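(* Let $U,V$ be linear subspaces of $\mathbb{R}^n$. For each $x\in\mathbb{R}^n$ we have $$\operatorname{dist}(C_T(x),U\cap V)^2=\operatorname{dist}(T(x),U\cap V)^2-\|T(x)-C_T(x)\|^2.$$ In particular, $$\operatorname{dist}(C_T(x),U\cap V)=\|C_T(x)-P_{U\cap V}(x)\|\le\|T(x)-P_{U\cap V}(x)\|=\operatorname{dist}(T(x),U\cap V).$$
   Context: $\mathbb{R}^n$ carries the Euclidean inner product and norm $\|\cdot\|$; $\operatorname{dist}(x,S)=\inf_{s\in S}\|x-s\|$. For a nonempty closed convex set $S\subset\mathbb{R}^n$, $P_S$ is the orthogonal projection onto $S$ and $R_S=2P_S-\mathrm{Id}$ is the reflection. Given $x$, set $y=R_U(x)$ and $z=R_VR_U(x)$. The Douglas--Rachford operator is $T=\frac{1}{2}(\mathrm{Id}+R_VR_U)$, so $T(x)=\frac{x+z}{2}$. $C_T(x)$ is the circumcenter of $\{x,y,z\}$, i.e. the unique point of the affine hull $\operatorname{aff}\{x,y,z\}$ that is equidistant to $x$, $y$ and $z$ (it exists and is unique for every $x$; if $x,y,z$ all coincide it is $x$, and if $\{x,y,z\}$ has exactly two elements it is their midpoint). *)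

theory Defs
  imports "HOL-Analysis.Analysis"
begin

definition reflection :: "'a::euclidean_space set \<Rightarrow> 'a \<Rightarrow> 'a" where
  "reflection S x = 2 *\<^sub>R closest_point S x - x"

definition DR_operator :: "'a::euclidean_space set \<Rightarrow> 'a set \<Rightarrow> 'a \<Rightarrow> 'a" where
  "DR_operator U V x = (1 / 2) *\<^sub>R (x + reflection V (reflection U x))"

(* Meaningful only when such a point exists, i.e. unless x, y, z are distinct and collinear.
   For coinciding points it yields the common point or the midpoint of the two distinct ones. *)
definition circumcenter :: "'a::euclidean_space \<Rightarrow> 'a \<Rightarrow> 'a \<Rightarrow> 'a" where
  "circumcenter x y z =
     (THE p. p \<in> affine hull {x, y, z} \<and> dist p x = dist p y \<and> dist p y = dist p z)"

definition CDR_operator :: "'a::euclidean_space set \<Rightarrow> 'a set \<Rightarrow> 'a \<Rightarrow> 'a" where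
  "CDR_operator U V x =
     circumcenter x (reflection U x) (reflection V (reflection U x))"

end

theory Submission
  imports Defs
begin

text \<open>
  Put \<open>W = U \<inter> V\<close>, \<open>y = R\<^sub>U x\<close>, \<open>z = R\<^sub>V y\<close>, \<open>A = aff {x, y, z}\<close>, and let \<open>c\<close> be the circumcenter of
  \<open>{x, y, z}\<close>. Reflections in \<open>U\<close> and \<open>V\<close> preserve the distance to every \<open>w \<in> W\<close>
  (\<open>dist_reflection\<close>), so \<open>x\<close>, \<open>y\<close>, \<open>z\<close> lie on a sphere about \<open>w\<close>; this sphere cuts \<open>A\<close> in a
  sphere whose center is the projection of \<open>w\<close> onto \<open>A\<close>. Hence all points of \<open>W\<close> project onto \<open>A\<close>
  at the same point, namely \<open>c\<close> (\<open>circumcenter_eq_closest_point\<close>); in particular \<open>c\<close> exists.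

  It follows that \<open>c - w\<close> is orthogonal to the directions of \<open>A\<close> for all \<open>w \<in> W\<close>, and subtracting
  the instance \<open>w = 0\<close> shows that \<open>W\<close> itself is orthogonal to these directions. Thus \<open>x\<close>, \<open>c\<close> and
  the midpoint \<open>T x\<close> of \<open>x\<close> and \<open>z\<close>, all in \<open>A\<close>, have the same projection \<open>p\<close> onto \<open>W\<close>. The
  triangle \<open>T x\<close>, \<open>c\<close>, \<open>p\<close> has a right angle at \<open>c\<close>, and Pythagoras gives everything.
\<close>

text \<open>
  A convex set only gives an inequality here. Affine sets contain, with \<open>a\<close>, the mirror image of
  \<open>a\<close> in the closest point, and the two inequalities combine to an equality.
\<close>
lemma closest_point_affine_orthogonal:
  fixes A :: "'a::euclidean_space set"
  assumes "affine A" and "a \<in> A"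
  shows "(w - closest_point A w) \<bullet> (a - closest_point A w) = 0"
proof -
  let ?c = "closest_point A w"
  have closed: "closed A" and conv: "convex A"
    using \<open>affine A\<close> by (simp_all add: affine_closed affine_imp_convex)
  have c: "?c \<in> A"
    using closed \<open>a \<in> A\<close> by (intro closest_point_in_set) auto
  have "2 *\<^sub>R ?c + (-1) *\<^sub>R a \<in> A"
    using \<open>affine A\<close> c \<open>a \<in> A\<close> by (intro mem_affine) auto
  from closest_point_dot[OF conv closed this, of w]
  have "(w - ?c) \<bullet> (?c - a) \<le> 0"
    by (simp add: scaleR_2)
  moreover have "(w - ?c) \<bullet> (a - ?c) \<le> 0"
    by (rule closest_point_dot[OF conv closed \<open>a \<in> A\<close>])
  ultimately show ?thesis
    by (simp add: inner_diff_right)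
qed

lemma infdist_eq_norm_orthogonal:
  fixes S :: "'a::real_inner set"
  assumes "subspace S" and "q \<in> S" and orth: "\<And>s. s \<in> S \<Longrightarrow> (a - q) \<bullet> s = 0"
  shows "infdist a S = norm (a - q)"
proof (rule antisym)
  show "infdist a S \<le> norm (a - q)"
    using infdist_le[OF \<open>q \<in> S\<close>, of a] by (simp add: dist_norm)
  have "norm (a - q) \<le> dist a s" if "s \<in> S" for s
  proof -
    have "(a - q) \<bullet> (q - s) = 0"
      using \<open>subspace S\<close> \<open>q \<in> S\<close> that by (intro orth subspace_diff)
    then have "(norm (a - s))\<^sup>2 = (norm (a - q))\<^sup>2 + (norm (q - s))\<^sup>2"
      using norm_add_Pythagorean[of "a - q" "q - s"] by (simp add: orthogonal_def)
    then have "(norm (a - q))\<^sup>2 \<le> (norm (a - s))\<^sup>2"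
      by simp
    then show ?thesis
      unfolding dist_norm by (rule power2_le_imp_le) simp
  qed
  then show "norm (a - q) \<le> infdist a S"
    using \<open>q \<in> S\<close> by (auto simp: infdist_def intro!: cINF_greatest)
qed

text \<open>
  Reflecting flips the sign of the component orthogonal to \<open>A\<close> and keeps the other one.
\<close>
lemma dist_reflection:
  fixes A :: "'a::euclidean_space set"
  assumes "affine A" and "w \<in> A"
  shows "dist w (reflection A x) = dist w x"
proof -
  let ?p = "closest_point A x"
  have orth: "(x - ?p) \<bullet> (w - ?p) = 0"
    by (rule closest_point_affine_orthogonal[OF assms])
  have "(norm ((w - ?p) + (x - ?p)))\<^sup>2 = (norm ((w - ?p) - (x - ?p)))\<^sup>2"
    using norm_add_Pythagorean[of "w - ?p" "x - ?p"] norm_add_Pythagorean[of "w - ?p" "- (x - ?p)"] orth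
    by (simp add: orthogonal_def inner_commute[of "w - ?p"] inner_minus_right del: minus_diff_eq)
  then have "norm ((w - ?p) + (x - ?p)) = norm ((w - ?p) - (x - ?p))"
    by simp
  then show ?thesis
    by (simp add: dist_norm reflection_def scaleR_2 algebra_simps)
qed

text \<open>
  Two points equidistant to \<open>x\<close>, \<open>y\<close>, \<open>z\<close> differ by a vector orthogonal to the directions of the
  affine hull; if both points lie in the hull, this vector is itself such a direction.
\<close>
lemma circumcenter_eqI:
  fixes x y z :: "'a::euclidean_space"
  assumes p: "p \<in> affine hull {x, y, z}" and "dist p x = dist p y" and "dist p y = dist p z"
  shows "circumcenter x y z = p"
  unfolding circumcenter_def
proof (rule the_equality)
  show "p \<in> affine hull {x, y, z} \<and> dist p x = dist p y \<and> dist p y = dist p z"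
    using assms by simp
next
  fix q
  assume q: "q \<in> affine hull {x, y, z} \<and> dist q x = dist q y \<and> dist q y = dist q z"
  let ?H = "{v. (q - p) \<bullet> v = (q - p) \<bullet> x}"
  have bisect: "(q - p) \<bullet> a = (q - p) \<bullet> b"
    if "dist p a = dist p b" and "dist q a = dist q b" for a b
  proof -
    have "(p - a) \<bullet> (p - a) = (p - b) \<bullet> (p - b)" "(q - a) \<bullet> (q - a) = (q - b) \<bullet> (q - b)"
      using that by (simp_all add: dist_norm norm_eq)
    then show ?thesis
      by (simp add: inner_diff_left inner_diff_right inner_commute)
  qed
  have "{x, y, z} \<subseteq> ?H"
    using bisect[of y x] bisect[of z x] assms q by auto
  then have "affine hull {x, y, z} \<subseteq> ?H"
    by (rule hull_minimal) (rule affine_hyperplane)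
  then have "(q - p) \<bullet> (q - p) = 0"
    using subsetD[OF _ p, of ?H] subsetD[OF _ conjunct1[OF q], of ?H] by (simp add: inner_diff_right)
  then show "q = p"
    by simp
qed

lemma circumcenter_eq_closest_point:
  fixes x y z w :: "'a::euclidean_space"
  assumes "dist w x = dist w y" and "dist w y = dist w z"
  shows "circumcenter x y z = closest_point (affine hull {x, y, z}) w"
proof -
  let ?A = "affine hull {x, y, z}"
  let ?c = "closest_point ?A w"
  have c: "?c \<in> ?A"
    by (rule closest_point_in_set) (simp_all add: affine_closed)
  have pyth: "(dist w a)\<^sup>2 = (dist w ?c)\<^sup>2 + (dist ?c a)\<^sup>2" if "a \<in> ?A" for a
  proof -
    have "orthogonal (w - ?c) (?c - a)"
      using closest_point_affine_orthogonal[OF affine_affine_hull that, of w]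
      by (simp add: orthogonal_def inner_diff_right)
    from norm_add_Pythagorean[OF this] show ?thesis
      by (simp add: dist_norm)
  qed
  have "x \<in> ?A" "y \<in> ?A" "z \<in> ?A"
    by (auto intro: hull_inc)
  then have "(dist ?c x)\<^sup>2 = (dist ?c y)\<^sup>2" "(dist ?c y)\<^sup>2 = (dist ?c z)\<^sup>2"
    using pyth[of x] pyth[of y] pyth[of z] assms by simp_all
  with c show ?thesis
    by (intro circumcenter_eqI) simp_all
qed

theorem lemma2p5:
  fixes U V :: "(real ^ 'n) set" and x :: "real ^ 'n"
  assumes "subspace U" and "subspace V"
  shows "(infdist (CDR_operator U V x) (U \<inter> V))\<^sup>2 =
           (infdist (DR_operator U V x) (U \<inter> V))\<^sup>2
             - (norm (DR_operator U V x - CDR_operator U V x))\<^sup>2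
       \<and> infdist (CDR_operator U V x) (U \<inter> V) =
           norm (CDR_operator U V x - closest_point (U \<inter> V) x)
       \<and> norm (CDR_operator U V x - closest_point (U \<inter> V) x)
           \<le> norm (DR_operator U V x - closest_point (U \<inter> V) x)
       \<and> norm (DR_operator U V x - closest_point (U \<inter> V) x) =
           infdist (DR_operator U V x) (U \<inter> V)"
proof -
  define W where "W = U \<inter> V"
  define y where "y = reflection U x"
  define z where "z = reflection V y"
  define A where "A = affine hull {x, y, z}"
  define c where "c = CDR_operator U V x"
  define t where "t = DR_operator U V x"
  define p where "p = closest_point W x"
  have W: "subspace W"
    unfolding W_def using assms by (rule subspace_inter)
  have pW: "p \<in> W"
    unfolding p_def using W subspace_0[OF W]
    by (intro closest_point_in_set closed_subspace) auto
  have affA: "affine A"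
    by (simp add: A_def)
  have xA: "x \<in> A" and zA: "z \<in> A"
    by (auto simp: A_def intro: hull_inc)
  have c_proj: "c = closest_point A w" if "w \<in> W" for w
  proof -
    have "dist w y = dist w x" "dist w z = dist w y"
      unfolding y_def z_def using that assms
      by (auto simp: W_def intro!: dist_reflection subspace_imp_affine)
    then show ?thesis
      unfolding c_def CDR_operator_def A_def y_def[symmetric] z_def[symmetric]
      by (intro circumcenter_eq_closest_point) simp_all
  qed
  have cA: "c \<in> A"
    unfolding c_proj[OF pW] using xA affA
    by (intro closest_point_in_set affine_closed) auto
  have tA: "t \<in> A"
  proof -
    have "t = (1/2) *\<^sub>R x + (1/2) *\<^sub>R z"
      by (simp add: t_def DR_operator_def y_def z_def scaleR_add_right)
    then show ?thesis
      using mem_affine[OF affA xA zA, of "1/2" "1/2"] by simp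
  qed
  have orth_A: "(w - c) \<bullet> (a - c) = 0" if "w \<in> W" "a \<in> A" for w a
    using closest_point_affine_orthogonal[OF affA that(2), of w] c_proj[OF that(1)] by simp
  have W_orth_A: "(a - c) \<bullet> w = 0" if "w \<in> W" "a \<in> A" for w a
    using orth_A[OF that] orth_A[OF subspace_0[OF W] that(2)]
    by (simp add: inner_commute[of "a - c"] inner_diff_left[of w])
  have x_orth: "(x - p) \<bullet> w = 0" if "w \<in> W" for w
  proof -
    \<comment> \<open>Translating by \<open>p\<close> turns a vector of \<open>W\<close> into a point of \<open>W\<close> compared with the foot \<open>p\<close>.\<close>
    have "(x - p) \<bullet> ((w + p) - p) = 0"
      unfolding p_def using W that pW[unfolded p_def]
      by (intro closest_point_affine_orthogonal subspace_imp_affine subspace_add)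
    then show ?thesis
      by simp
  qed
  have A_orth: "(a - p) \<bullet> w = 0" if "w \<in> W" "a \<in> A" for w a
    using x_orth[OF that(1)] W_orth_A[OF that] W_orth_A[OF that(1) xA]
    by (simp add: inner_diff_left)
  have dist_c: "infdist c W = norm (c - p)" and dist_t: "infdist t W = norm (t - p)"
    using A_orth cA tA by (auto intro: infdist_eq_norm_orthogonal[OF W pW])
  have "orthogonal (t - c) (c - p)"
    using orth_A[OF pW tA]
    by (simp add: orthogonal_def inner_commute[of "t - c"] inner_diff_left[of p] inner_diff_left[of c])
  from norm_add_Pythagorean[OF this]
  have pyth: "(norm (t - p))\<^sup>2 = (norm (t - c))\<^sup>2 + (norm (c - p))\<^sup>2"
    by simp
  then have "(norm (c - p))\<^sup>2 \<le> (norm (t - p))\<^sup>2"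
    by simp
  then have "norm (c - p) \<le> norm (t - p)"
    by (rule power2_le_imp_le) simp
  with pyth dist_c dist_t show ?thesis
    unfolding c_def t_def p_def W_def by simp
qed

end
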